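(* Let $(M;\vee,\wedge,\oplus,0)$ be an $EMV$-algebra. If $\theta$ is a congruence on $M$, then $I_\theta:=0/\theta$ (the $\theta$-class of $0$) is an ideal of $M$. Conversely, let $I$ be an ideal of $M$. Then the relation $\theta_I$ on $M$ defined by $$(x,y)\in\theta_I \iff \exists\, b\in\mathcal I(M):\ x,y\le b,\ \lambda_b(\lambda_b(x)\oplus y)\in I \text{ and } \lambda_b(\lambda_b(y)\oplus x)\in I$$ is a congruence on $M$. In addition, the mapping $I\mapsto\theta_I$ is a bijection from the set $\mathrm{Ideal}(M)$ of all ideals of $M$ onto the set of all congruences on $M$.
   Context: An algebra $(M;\vee,\wedge,\oplus,0)$ of type $(2,2,2,0)$ is an $EMV$-algebra if: (1) $(M;\vee,\wedge,0)$ is a distributive lattice with least element $0$; (2) $(M;\oplus,0)$ is a commutative ordered monoid with neutral element $0$ (so $x\le y$ implies $x\oplus z\le y\oplus z$); (3) writing $\mathcal I(M)=\{a\in M: a\oplus a=a\}$ for the set of idempotents, for all $a,b\in\mathcal I(M)$ with $a\le b$ and all $x\in[a,b]$ the element $\lambda_{a,b}(x)=\min\{z\in[a,b]: x\oplus z=b\}$ exists in $M$, and $([a,b];\oplus,\lambda_{a,b},a,b)$ is an $MV$-algebra; (4) for each $x\in M$ there is $a\in\mathcal I(M)$ with $x\le a$. We write $\lambda_b:=\lambda_{0,b}$. A congruence on $M$ is an equivalence relation $\theta$ on $M$ compatible with $\vee,\wedge,\oplus$ such that for all $b\in\mathcal I(M)$, $\theta\cap([0,b]\times[0,b])$ is a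 congruence of the $MV$-algebra $([0,b];\oplus,\lambda_b,0,b)$. An ideal of $M$ is a non-empty subset $I\subseteq M$ closed under $\oplus$ and such that $x\le y\in I$ implies $x\in I$. *)

theory Defs
  imports "HOL-Algebra.Group"
begin

record 'a add_struct = "'a partial_object" +
  oplus :: "'a \<Rightarrow> 'a \<Rightarrow> 'a" (infixl \<open>\<oplus>\<index>\<close> 65)
  zero  :: "'a" (\<open>\<zero>\<index>\<close>)

definition oplus_monoid :: "('a, 'b) add_struct_scheme \<Rightarrow> 'a monoid" where
  "oplus_monoid M = \<lparr>carrier = carrier M, mult = oplus M, one = zero M\<rparr>"

record 'a mv_struct = "'a add_struct" +
  mv_neg :: "'a \<Rightarrow> 'a"
  mv_top :: "'a"

text \<open>
  The constant \<open>1\<close> is part of the signature. The law \<open>0' = 1\<close>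
  does not follow from the remaining ones: on \<open>{0,1}\<close> with \<open>\<oplus>\<close> the maximum,
  the identity as negation satisfies all of them.
\<close>

locale mv_algebra =
  fixes A (structure)
  assumes comm_monoid: "comm_monoid (oplus_monoid A)"
    and neg_closed: "x \<in> carrier A \<Longrightarrow> mv_neg A x \<in> carrier A"
    and top_closed: "mv_top A \<in> carrier A"
    and neg_zero: "mv_neg A \<zero> = mv_top A"
    and neg_neg: "x \<in> carrier A \<Longrightarrow> mv_neg A (mv_neg A x) = x"
    and oplus_top: "x \<in> carrier A \<Longrightarrow> x \<oplus> mv_top A = mv_top A"
    and lukasiewicz: "\<lbrakk>x \<in> carrier A; y \<in> carrier A\<rbrakk> \<Longrightarrow>
      x \<oplus> mv_neg A (x \<oplus> mv_neg A y) = y \<oplus> mv_neg A (y \<oplus> mv_neg A x)"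

definition compatible2 :: "('a \<times> 'a) set \<Rightarrow> ('a \<Rightarrow> 'a \<Rightarrow> 'a) \<Rightarrow> bool" where
  "compatible2 \<theta> f \<longleftrightarrow>
     (\<forall>x x' y y'. (x, x') \<in> \<theta> \<longrightarrow> (y, y') \<in> \<theta> \<longrightarrow> (f x y, f x' y') \<in> \<theta>)"

definition mv_congruence :: "('a, 'b) mv_struct_scheme \<Rightarrow> ('a \<times> 'a) set \<Rightarrow> bool" where
  "mv_congruence A \<theta> \<longleftrightarrow>
     equiv (carrier A) \<theta> \<and> compatible2 \<theta> (oplus A) \<and>
     (\<forall>x y. (x, y) \<in> \<theta> \<longrightarrow> (mv_neg A x, mv_neg A y) \<in> \<theta>)"

record 'a emv_struct = "'a add_struct" +
  vee   :: "'a \<Rightarrow> 'a \<Rightarrow> 'a" (infixl \<open>\<curlyvee>\<index>\<close> 65)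
  wedge :: "'a \<Rightarrow> 'a \<Rightarrow> 'a" (infixl \<open>\<curlywedge>\<index>\<close> 70)

definition emv_order :: "('a, 'b) emv_struct_scheme \<Rightarrow> 'a gorder" where
  "emv_order M = \<lparr>carrier = carrier M, eq = (=), le = (\<lambda>x y. x \<curlywedge>\<^bsub>M\<^esub> y = x)\<rparr>"

definition idempotents :: "('a, 'b) emv_struct_scheme \<Rightarrow> 'a set" where
  "idempotents M = {a \<in> carrier M. a \<oplus>\<^bsub>M\<^esub> a = a}"

abbreviation emv_interval :: "('a, 'b) emv_struct_scheme \<Rightarrow> 'a \<Rightarrow> 'a \<Rightarrow> 'a set" where
  "emv_interval M a b \<equiv> \<lbrace>a..b\<rbrace>\<^bsub>emv_order M\<^esub>"

definition is_emv_lambda ::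
  "('a, 'b) emv_struct_scheme \<Rightarrow> 'a \<Rightarrow> 'a \<Rightarrow> 'a \<Rightarrow> 'a \<Rightarrow> bool" where
  "is_emv_lambda M a b x z \<longleftrightarrow>
     least (emv_order M) z {z \<in> emv_interval M a b. x \<oplus>\<^bsub>M\<^esub> z = b}"

definition emv_lambda :: "('a, 'b) emv_struct_scheme \<Rightarrow> 'a \<Rightarrow> 'a \<Rightarrow> 'a \<Rightarrow> 'a" where
  "emv_lambda M a b x = (THE z. is_emv_lambda M a b x z)"

definition interval_mv :: "('a, 'b) emv_struct_scheme \<Rightarrow> 'a \<Rightarrow> 'a \<Rightarrow> 'a mv_struct" where
  "interval_mv M a b =
     \<lparr>carrier = emv_interval M a b, oplus = oplus M, zero = a,
      mv_neg = emv_lambda M a b, mv_top = b\<rparr>"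

locale emv_algebra =
  fixes M (structure)
  assumes vee_closed: "\<lbrakk>x \<in> carrier M; y \<in> carrier M\<rbrakk> \<Longrightarrow> x \<curlyvee> y \<in> carrier M"
    and wedge_closed: "\<lbrakk>x \<in> carrier M; y \<in> carrier M\<rbrakk> \<Longrightarrow> x \<curlywedge> y \<in> carrier M"
    and vee_comm: "\<lbrakk>x \<in> carrier M; y \<in> carrier M\<rbrakk> \<Longrightarrow> x \<curlyvee> y = y \<curlyvee> x"
    and wedge_comm: "\<lbrakk>x \<in> carrier M; y \<in> carrier M\<rbrakk> \<Longrightarrow> x \<curlywedge> y = y \<curlywedge> x"
    and vee_assoc: "\<lbrakk>x \<in> carrier M; y \<in> carrier M; z \<in> carrier M\<rbrakk> \<Longrightarrow>
      (x \<curlyvee> y) \<curlyvee> z = x \<curlyvee> (y \<curlyvee> z)"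
    and wedge_assoc: "\<lbrakk>x \<in> carrier M; y \<in> carrier M; z \<in> carrier M\<rbrakk> \<Longrightarrow>
      (x \<curlywedge> y) \<curlywedge> z = x \<curlywedge> (y \<curlywedge> z)"
    and vee_absorb: "\<lbrakk>x \<in> carrier M; y \<in> carrier M\<rbrakk> \<Longrightarrow> x \<curlyvee> (x \<curlywedge> y) = x"
    and wedge_absorb: "\<lbrakk>x \<in> carrier M; y \<in> carrier M\<rbrakk> \<Longrightarrow> x \<curlywedge> (x \<curlyvee> y) = x"
    and wedge_vee_distrib: "\<lbrakk>x \<in> carrier M; y \<in> carrier M; z \<in> carrier M\<rbrakk> \<Longrightarrow>
      x \<curlywedge> (y \<curlyvee> z) = (x \<curlywedge> y) \<curlyvee> (x \<curlywedge> z)"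
    and zero_least: "least (emv_order M) \<zero> (carrier M)"
    and comm_monoid: "comm_monoid (oplus_monoid M)"
    and oplus_mono: "\<lbrakk>x \<in> carrier M; y \<in> carrier M; z \<in> carrier M; x \<sqsubseteq>\<^bsub>emv_order M\<^esub> y\<rbrakk> \<Longrightarrow>
      x \<oplus> z \<sqsubseteq>\<^bsub>emv_order M\<^esub> y \<oplus> z"
    and lambda_exists: "\<lbrakk>a \<in> idempotents M; b \<in> idempotents M; a \<sqsubseteq>\<^bsub>emv_order M\<^esub> b;
      x \<in> emv_interval M a b\<rbrakk> \<Longrightarrow> \<exists>z. is_emv_lambda M a b x z"
    and interval_mv_algebra: "\<lbrakk>a \<in> idempotents M; b \<in> idempotents M; a \<sqsubseteq>\<^bsub>emv_order M\<^esub> b\<rbrakk> \<Longrightarrow>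
      mv_algebra (interval_mv M a b)"
    and idempotent_above: "x \<in> carrier M \<Longrightarrow> \<exists>a \<in> idempotents M. x \<sqsubseteq>\<^bsub>emv_order M\<^esub> a"

definition emv_congruence :: "('a, 'b) emv_struct_scheme \<Rightarrow> ('a \<times> 'a) set \<Rightarrow> bool" where
  "emv_congruence M \<theta> \<longleftrightarrow>
     equiv (carrier M) \<theta> \<and>
     compatible2 \<theta> (vee M) \<and> compatible2 \<theta> (wedge M) \<and> compatible2 \<theta> (oplus M) \<and>
     (\<forall>b \<in> idempotents M. mv_congruence (interval_mv M \<zero>\<^bsub>M\<^esub> b)
        (\<theta> \<inter> emv_interval M \<zero>\<^bsub>M\<^esub> b \<times> emv_interval M \<zero>\<^bsub>M\<^esub> b))"

definition emv_ideal :: "('a, 'b) emv_struct_scheme \<Rightarrow> 'a set \<Rightarrow> bool" where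
  "emv_ideal M I \<longleftrightarrow>
     I \<subseteq> carrier M \<and> I \<noteq> {} \<and>
     (\<forall>x \<in> I. \<forall>y \<in> I. x \<oplus>\<^bsub>M\<^esub> y \<in> I) \<and>
     (\<forall>x \<in> carrier M. \<forall>y \<in> I. x \<sqsubseteq>\<^bsub>emv_order M\<^esub> y \<longrightarrow> x \<in> I)"

definition ideal_congruence :: "('a, 'b) emv_struct_scheme \<Rightarrow> 'a set \<Rightarrow> ('a \<times> 'a) set" where
  "ideal_congruence M I =
     {(x, y). x \<in> carrier M \<and> y \<in> carrier M \<and>
       (\<exists>b \<in> idempotents M. x \<sqsubseteq>\<^bsub>emv_order M\<^esub> b \<and> y \<sqsubseteq>\<^bsub>emv_order M\<^esub> b \<and>
          emv_lambda M \<zero>\<^bsub>M\<^esub> b (emv_lambda M \<zero>\<^bsub>M\<^esub> b x \<oplus>\<^bsub>M\<^esub> y) \<in> I \<and>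
          emv_lambda M \<zero>\<^bsub>M\<^esub> b (emv_lambda M \<zero>\<^bsub>M\<^esub> b y \<oplus>\<^bsub>M\<^esub> x) \<in> I)}"

end

(*
  The relation of an ideal I has a description without any reference to an idempotent b:
  x and y are related iff x <= y + i and y <= x + i for some i in I. Most of the congruence
  properties are immediate from this form; those for the meet and for lambda_b rest on the
  distributivity of + over the meet, which follows from the residuation
  z <= w + k <-> lambda_b (lambda_b z + k) <= w in [0,b]. Conversely, if theta is a congruence,
  i is theta-related to 0 and x <= y + i, then x = x /\ (y + i) is theta-related to x /\ y;
  by symmetry so is y, hence theta is determined by the class of 0.
*)
theory Submission
  imports Defs
begin

context emv_algebra
begin

section \<open>Order, lattice and monoid laws of an EMV-algebra\<close>

abbreviation below :: "'a \<Rightarrow> 'a \<Rightarrow> bool" (infix \<open>\<preceq>\<close> 50) where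
  "x \<preceq> y \<equiv> x \<sqsubseteq>\<^bsub>emv_order M\<^esub> y"

lemma below_iff: "x \<preceq> y \<longleftrightarrow> x \<curlywedge> y = x"
  by (simp add: emv_order_def)

lemma oplus_closed [simp]: "\<lbrakk>x \<in> carrier M; y \<in> carrier M\<rbrakk> \<Longrightarrow> x \<oplus> y \<in> carrier M"
  using Group.comm_monoid.axioms(1)[OF comm_monoid] monoid.m_closed
  by (fastforce simp: oplus_monoid_def)

lemma zero_closed [simp]: "\<zero> \<in> carrier M"
  using zero_least by (simp add: least_def)

lemma oplus_comm: "\<lbrakk>x \<in> carrier M; y \<in> carrier M\<rbrakk> \<Longrightarrow> x \<oplus> y = y \<oplus> x"
  using comm_monoid.m_comm[OF comm_monoid, of x y] by (simp add: oplus_monoid_def)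

lemma oplus_assoc:
  "\<lbrakk>x \<in> carrier M; y \<in> carrier M; z \<in> carrier M\<rbrakk> \<Longrightarrow> (x \<oplus> y) \<oplus> z = x \<oplus> (y \<oplus> z)"
  using monoid.m_assoc[OF Group.comm_monoid.axioms(1)[OF comm_monoid], of x y z]
  by (simp add: oplus_monoid_def)

lemma oplus_left_comm:
  "\<lbrakk>x \<in> carrier M; y \<in> carrier M; z \<in> carrier M\<rbrakk> \<Longrightarrow> x \<oplus> (y \<oplus> z) = y \<oplus> (x \<oplus> z)"
  by (metis oplus_assoc oplus_comm)

lemma oplus_zero [simp]: "x \<in> carrier M \<Longrightarrow> x \<oplus> \<zero> = x"
  using monoid.r_one[OF Group.comm_monoid.axioms(1)[OF comm_monoid], of x]
  by (simp add: oplus_monoid_def)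

lemma zero_oplus [simp]: "x \<in> carrier M \<Longrightarrow> \<zero> \<oplus> x = x"
  using oplus_comm[of \<zero> x] by simp

lemma zero_below [simp]: "x \<in> carrier M \<Longrightarrow> \<zero> \<preceq> x"
  using zero_least by (simp add: least_def)

lemma below_refl [simp]: "x \<in> carrier M \<Longrightarrow> x \<preceq> x"
  unfolding below_iff by (metis vee_absorb wedge_absorb wedge_closed)

lemma below_antisym:
  "\<lbrakk>x \<preceq> y; y \<preceq> x; x \<in> carrier M; y \<in> carrier M\<rbrakk> \<Longrightarrow> x = y"
  unfolding below_iff by (metis wedge_comm)

lemma below_trans:
  "\<lbrakk>x \<preceq> y; y \<preceq> z; x \<in> carrier M; y \<in> carrier M; z \<in> carrier M\<rbrakk> \<Longrightarrow> x \<preceq> z"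
  unfolding below_iff by (metis wedge_assoc)

lemma wedge_below1: "\<lbrakk>x \<in> carrier M; y \<in> carrier M\<rbrakk> \<Longrightarrow> x \<curlywedge> y \<preceq> x"
  using below_refl unfolding below_iff by (metis wedge_assoc wedge_comm)

lemma wedge_below2: "\<lbrakk>x \<in> carrier M; y \<in> carrier M\<rbrakk> \<Longrightarrow> x \<curlywedge> y \<preceq> y"
  by (metis wedge_below1 wedge_comm)

lemma wedge_greatest:
  "\<lbrakk>z \<preceq> x; z \<preceq> y; x \<in> carrier M; y \<in> carrier M; z \<in> carrier M\<rbrakk> \<Longrightarrow> z \<preceq> x \<curlywedge> y"
  unfolding below_iff by (metis wedge_assoc)

lemma below_vee1: "\<lbrakk>x \<in> carrier M; y \<in> carrier M\<rbrakk> \<Longrightarrow> x \<preceq> x \<curlyvee> y"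
  unfolding below_iff by (simp add: wedge_absorb)

lemma below_vee2: "\<lbrakk>x \<in> carrier M; y \<in> carrier M\<rbrakk> \<Longrightarrow> y \<preceq> x \<curlyvee> y"
  by (metis below_vee1 vee_comm)

lemma vee_least:
  "\<lbrakk>x \<preceq> z; y \<preceq> z; x \<in> carrier M; y \<in> carrier M; z \<in> carrier M\<rbrakk> \<Longrightarrow> x \<curlyvee> y \<preceq> z"
  unfolding below_iff by (metis vee_closed wedge_comm wedge_vee_distrib)

lemma oplus_mono2:
  assumes "x \<preceq> x'" "y \<preceq> y'"
    and [simp]: "x \<in> carrier M" "x' \<in> carrier M" "y \<in> carrier M" "y' \<in> carrier M"
  shows "x \<oplus> y \<preceq> x' \<oplus> y'"
proof -
  have "x \<oplus> y \<preceq> x' \<oplus> y" "x' \<oplus> y \<preceq> x' \<oplus> y'"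
    using oplus_mono[of x x' y] oplus_mono[of y y' x'] assms by (simp_all add: oplus_comm)
  then show ?thesis by (rule below_trans) simp_all
qed

lemma below_oplus1: "\<lbrakk>x \<in> carrier M; y \<in> carrier M\<rbrakk> \<Longrightarrow> x \<preceq> x \<oplus> y"
  using oplus_mono2[of x x \<zero> y] by simp

lemma below_oplus2: "\<lbrakk>x \<in> carrier M; y \<in> carrier M\<rbrakk> \<Longrightarrow> y \<preceq> x \<oplus> y"
  using below_oplus1[of y x] by (simp add: oplus_comm)

section \<open>Idempotents and the negation \<open>emv_lambda M \<zero> b\<close> of the interval
  [0,b]\<close>

lemma idempotentD: "b \<in> idempotents M \<Longrightarrow> b \<in> carrier M \<and> b \<oplus> b = b"
  by (simp add: idempotents_def)

lemma zero_idempotent: "\<zero> \<in> idempotents M"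
  by (simp add: idempotents_def)

lemma interval_iff: "x \<in> emv_interval M \<zero> b \<longleftrightarrow> x \<in> carrier M \<and> x \<preceq> b"
  by (auto simp: at_least_at_most_def) (auto simp: emv_order_def)

lemma oplus_below_idempotent:
  assumes "b \<in> idempotents M" "x \<in> carrier M" "y \<in> carrier M" "x \<preceq> b" "y \<preceq> b"
  shows "x \<oplus> y \<preceq> b"
  using oplus_mono2[of x b y b] idempotentD[OF assms(1)] assms by simp

text \<open>\<open>emv_lambda\<close> is a definite description. A least element is unique by
  antisymmetry, so the existence axiom is all it takes for the description to denote.\<close>

lemma is_emv_lambda_emv_lambda:
  assumes b: "b \<in> idempotents M" and x: "x \<in> carrier M" "x \<preceq> b"
  shows "is_emv_lambda M \<zero> b x (emv_lambda M \<zero> b x)"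
proof -
  have "\<exists>z. is_emv_lambda M \<zero> b x z"
    using lambda_exists[OF zero_idempotent b] x idempotentD[OF b] by (simp add: interval_iff)
  then obtain z where z: "is_emv_lambda M \<zero> b x z" ..
  have "z' = z" if "is_emv_lambda M \<zero> b x z'" for z'
    using that z by (auto simp: is_emv_lambda_def least_def interval_iff intro: below_antisym)
  then show ?thesis
    unfolding emv_lambda_def using z by (metis theI)
qed

lemma emv_lambda:
  assumes "b \<in> idempotents M" "x \<in> carrier M" "x \<preceq> b"
  shows emv_lambda_closed: "emv_lambda M \<zero> b x \<in> carrier M"
    and emv_lambda_below: "emv_lambda M \<zero> b x \<preceq> b"
    and oplus_emv_lambda: "x \<oplus> emv_lambda M \<zero> b x = b"
  using is_emv_lambda_emv_lambda[OF assms]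
  by (auto simp: is_emv_lambda_def least_def interval_iff)

text \<open>Minimality is defined among exact solutions of x + z = b. An inequality is enough here:
  b is idempotent, so sums of elements of [0,b] stay below b.\<close>

lemma emv_lambda_least:
  assumes b: "b \<in> idempotents M" and x: "x \<in> carrier M" "x \<preceq> b"
    and z: "z \<in> carrier M" "z \<preceq> b" "b \<preceq> x \<oplus> z"
  shows "emv_lambda M \<zero> b x \<preceq> z"
proof -
  have "x \<oplus> z = b"
    using oplus_below_idempotent[OF b] x z idempotentD[OF b] by (intro below_antisym) auto
  then show ?thesis
    using is_emv_lambda_emv_lambda[OF b x] z(1,2)
    by (auto simp: is_emv_lambda_def least_def interval_iff)
qed

text \<open>This is the double negation law of the MV-algebra [0,b], and the point where the
  MV-axioms of the intervals enter.\<close>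

lemma emv_lambda_involutive:
  assumes b: "b \<in> idempotents M" and x: "x \<in> carrier M" "x \<preceq> b"
  shows "emv_lambda M \<zero> b (emv_lambda M \<zero> b x) = x"
proof -
  have "mv_algebra (interval_mv M \<zero> b)"
    using interval_mv_algebra[OF zero_idempotent b] idempotentD[OF b] by simp
  from mv_algebra.neg_neg[OF this, of x] x show ?thesis
    by (simp add: interval_mv_def interval_iff)
qed

lemma emv_lambda_top: "b \<in> idempotents M \<Longrightarrow> emv_lambda M \<zero> b b = \<zero>"
  using emv_lambda_least[of b b \<zero>] emv_lambda_closed[of b b] idempotentD[of b]
  by (auto intro: below_antisym)

lemma idempotent_above2:
  assumes "x \<in> carrier M" "y \<in> carrier M"
  obtains b where "b \<in> idempotents M" "x \<preceq> b" "y \<preceq> b"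
proof -
  obtain b where b: "b \<in> idempotents M" "x \<oplus> y \<preceq> b"
    using idempotent_above[of "x \<oplus> y"] assms by auto
  with that show ?thesis
    using below_trans below_oplus1 below_oplus2 idempotentD assms by (meson oplus_closed)
qed

section \<open>Truncated difference, residuation and errors in inequalities\<close>

abbreviation emv_diff :: "'a \<Rightarrow> 'a \<Rightarrow> 'a \<Rightarrow> 'a" where
  "emv_diff b x y \<equiv> emv_lambda M \<zero> b (emv_lambda M \<zero> b x \<oplus> y)"

text \<open>\<open>emv_diff b x y\<close> is the truncated difference "x minus y" of the MV-algebra
  [0,b]. The last two claims characterise it as the least z in [0,b] with x \<le> y + z, and all
  later arguments use it through this property.\<close>

lemma emv_diff_residuated:
  assumes b: "b \<in> idempotents M"
    and x: "x \<in> carrier M" "x \<preceq> b" and y: "y \<in> carrier M" "y \<preceq> b"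
  shows emv_diff_closed: "emv_diff b x y \<in> carrier M"
    and below_oplus_emv_diff: "x \<preceq> y \<oplus> emv_diff b x y"
    and emv_diff_below: "\<lbrakk>z \<in> carrier M; z \<preceq> b; x \<preceq> y \<oplus> z\<rbrakk> \<Longrightarrow> emv_diff b x y \<preceq> z"
proof -
  note [simp] = x y
  note lx [simp] = emv_lambda_closed[OF b x] emv_lambda_below[OF b x]
  have s [simp]: "emv_lambda M \<zero> b x \<oplus> y \<in> carrier M" "emv_lambda M \<zero> b x \<oplus> y \<preceq> b"
    using oplus_below_idempotent[OF b] by simp_all
  note u [simp] = emv_lambda_closed[OF b s] emv_lambda_below[OF b s]
  have [simp]: "b \<in> carrier M" using idempotentD[OF b] by simp
  show "emv_diff b x y \<in> carrier M" by simp
  \<comment> \<open>Since x is the negation of \<open>emv_lambda M \<zero> b x\<close>, minimality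
    applies to x itself: adding the right-hand side to that negation gives s + lambda_b s = b, where
    s is the sum inside the difference.\<close>
  have "emv_lambda M \<zero> b (emv_lambda M \<zero> b x) \<preceq> y \<oplus> emv_diff b x y"
    by (rule emv_lambda_least[OF b])
      (use oplus_emv_lambda[OF b s] in \<open>simp_all add: oplus_below_idempotent[OF b] oplus_assoc[symmetric]\<close>)
  then show "x \<preceq> y \<oplus> emv_diff b x y"
    by (simp add: emv_lambda_involutive[OF b x])
  assume z: "z \<in> carrier M" "z \<preceq> b" "x \<preceq> y \<oplus> z"
  \<comment> \<open>Adding lambda_b x to both sides of x \<le> y + z turns the left side into b, so
    z competes with the difference.\<close>
  have "emv_lambda M \<zero> b x \<oplus> x \<preceq> emv_lambda M \<zero> b x \<oplus> (y \<oplus> z)"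
    using z by (intro oplus_mono2) simp_all
  then have "b \<preceq> (emv_lambda M \<zero> b x \<oplus> y) \<oplus> z"
    using oplus_emv_lambda[OF b x] z by (simp add: oplus_assoc oplus_comm[of _ x])
  then show "emv_diff b x y \<preceq> z"
    using z by (simp add: emv_lambda_least[OF b])
qed

text \<open>This is the nontrivial half of distributivity of + over the meet. For z the meet of the
  two sums, the difference u of z and k is below x and below y by residuation, hence below their
  meet. Adding k back gives z \<le> k + u, which yields the bound.\<close>

lemma wedge_oplus_subdistrib:
  assumes [simp]: "x \<in> carrier M" "y \<in> carrier M" "k \<in> carrier M"
  shows "(k \<oplus> x) \<curlywedge> (k \<oplus> y) \<preceq> k \<oplus> (x \<curlywedge> y)"
proof -
  note [simp] = wedge_closed
  \<comment> \<open>With b above both sums, the elements x, y, k and z all lie in [0,b], where the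
    difference is available.\<close>
  obtain b where b: "b \<in> idempotents M" and le: "k \<oplus> x \<preceq> b" "k \<oplus> y \<preceq> b"
    using idempotent_above2[of "k \<oplus> x" "k \<oplus> y"] by auto
  have [simp]: "b \<in> carrier M" using idempotentD[OF b] by simp
  have k: "k \<preceq> b" and x: "x \<preceq> b" and y: "y \<preceq> b"
    using le below_trans[OF below_oplus1 le(1)] below_trans[OF below_oplus2 le(1)]
      below_trans[OF below_oplus2 le(2)] by simp_all
  define z where "z = (k \<oplus> x) \<curlywedge> (k \<oplus> y)"
  have [simp]: "z \<in> carrier M" and z: "z \<preceq> k \<oplus> x" "z \<preceq> k \<oplus> y"
    unfolding z_def by (simp_all add: wedge_below1 wedge_below2)
  have zb: "z \<preceq> b" using below_trans[OF z(1) le(1)] by simp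
  define u where "u = emv_diff b z k"
  have [simp]: "u \<in> carrier M" unfolding u_def using emv_diff_closed[OF b _ zb _ k] by simp
  have "u \<preceq> x" "u \<preceq> y"
    unfolding u_def using emv_diff_below[OF b _ zb _ k] x y z by simp_all
  then have "k \<oplus> u \<preceq> k \<oplus> (x \<curlywedge> y)"
    by (intro oplus_mono2 wedge_greatest) simp_all
  moreover have "z \<preceq> k \<oplus> u"
    unfolding u_def using below_oplus_emv_diff[OF b _ zb _ k] by simp
  ultimately show ?thesis
    unfolding z_def[symmetric] by (meson below_trans \<open>z \<in> carrier M\<close> \<open>u \<in> carrier M\<close>
      oplus_closed wedge_closed assms)
qed

text \<open>An error term i need not lie below b, whereas residuation and lambda_b work only inside
  [0,b]. Truncating i to its meet with b is harmless: x is below both y + i and y + b, and +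
  distributes over the meet.\<close>

lemma below_oplus_wedge:
  assumes "x \<preceq> y \<oplus> i" "x \<preceq> b"
    and [simp]: "x \<in> carrier M" "y \<in> carrier M" "i \<in> carrier M" "b \<in> carrier M"
  shows "x \<preceq> y \<oplus> (i \<curlywedge> b)"
proof -
  have "x \<preceq> y \<oplus> b"
    using below_trans[OF assms(2) below_oplus2] by simp
  then have "x \<preceq> (y \<oplus> i) \<curlywedge> (y \<oplus> b)"
    using assms(1) by (intro wedge_greatest) simp_all
  then show ?thesis
    by (rule below_trans[OF _ wedge_oplus_subdistrib]) (simp_all add: wedge_closed)
qed

text \<open>Negation reverses the order even up to an error i, with the same i. The reason is that
  lambda_b x plus the truncated error is a z with b \<le> y + z, so lambda_b y lies below it by
  minimality.\<close>

lemma emv_lambda_antimono_mod: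
  assumes b: "b \<in> idempotents M"
    and x: "x \<in> carrier M" "x \<preceq> b" and y: "y \<in> carrier M" "y \<preceq> b"
    and i [simp]: "i \<in> carrier M" and le: "x \<preceq> y \<oplus> i"
  shows "emv_lambda M \<zero> b y \<preceq> emv_lambda M \<zero> b x \<oplus> i"
proof -
  note [simp] = x y wedge_closed
  note [simp] = emv_lambda_closed[OF b x] emv_lambda_below[OF b x] emv_lambda_closed[OF b y]
  have [simp]: "b \<in> carrier M" using idempotentD[OF b] by simp
  let ?z = "emv_lambda M \<zero> b x \<oplus> (i \<curlywedge> b)"
  have "emv_lambda M \<zero> b x \<oplus> x \<preceq> emv_lambda M \<zero> b x \<oplus> (y \<oplus> (i \<curlywedge> b))"
    using below_oplus_wedge[OF le x(2)] by (intro oplus_mono2) simp_all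
  then have "b \<preceq> y \<oplus> ?z"
    using oplus_emv_lambda[OF b x] by (simp add: oplus_comm[of _ x] oplus_left_comm[of y])
  then have "emv_lambda M \<zero> b y \<preceq> ?z"
    by (simp add: emv_lambda_least[OF b] oplus_below_idempotent[OF b] wedge_below2)
  moreover have "?z \<preceq> emv_lambda M \<zero> b x \<oplus> i"
    by (intro oplus_mono2) (simp_all add: wedge_below1)
  ultimately show ?thesis by (rule below_trans) simp_all
qed

section \<open>Ideals and the congruence they induce\<close>

lemma emv_idealD:
  assumes "emv_ideal M I"
  shows ideal_closed: "x \<in> I \<Longrightarrow> x \<in> carrier M"
    and ideal_oplus: "\<lbrakk>x \<in> I; y \<in> I\<rbrakk> \<Longrightarrow> x \<oplus> y \<in> I"
    and ideal_down: "\<lbrakk>x \<preceq> y; y \<in> I; x \<in> carrier M\<rbrakk> \<Longrightarrow> x \<in> I"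
  using assms unfolding emv_ideal_def by blast+

lemma ideal_zero:
  assumes I: "emv_ideal M I"
  shows "\<zero> \<in> I"
proof -
  obtain x where "x \<in> I" using I by (auto simp: emv_ideal_def)
  then show ?thesis
    using ideal_down[OF I zero_below] ideal_closed[OF I] by simp
qed

text \<open>From left to right, the sum of the two differences serves as a single i for both
  inequalities. From right to left, residuation puts both differences below the meet of i and b,
  which belongs to I; any idempotent b above x and y will do.\<close>

lemma ideal_congruence_iff:
  assumes I: "emv_ideal M I"
  shows "(x, y) \<in> ideal_congruence M I \<longleftrightarrow>
    x \<in> carrier M \<and> y \<in> carrier M \<and> (\<exists>i\<in>I. x \<preceq> y \<oplus> i \<and> y \<preceq> x \<oplus> i)"
    (is "?L \<longleftrightarrow> ?R")
proof
  assume ?L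
  then obtain b where [simp]: "x \<in> carrier M" "y \<in> carrier M"
    and b: "b \<in> idempotents M" and le: "x \<preceq> b" "y \<preceq> b"
    and mem: "emv_diff b x y \<in> I" "emv_diff b y x \<in> I"
    by (auto simp: ideal_congruence_def)
  have mono: "s \<oplus> i \<preceq> s \<oplus> (i \<oplus> j)" "s \<oplus> j \<preceq> s \<oplus> (i \<oplus> j)"
    if "s \<in> carrier M" "i \<in> carrier M" "j \<in> carrier M" for s i j
    using that by (auto intro!: oplus_mono2 simp: below_oplus1 below_oplus2)
  note [simp] = emv_diff_closed[OF b _ le(1) _ le(2)] emv_diff_closed[OF b _ le(2) _ le(1)]
  have "x \<preceq> y \<oplus> (emv_diff b x y \<oplus> emv_diff b y x)"
    by (rule below_trans[OF below_oplus_emv_diff[OF b _ le(1) _ le(2)] mono(1)]) simp_all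
  moreover have "y \<preceq> x \<oplus> (emv_diff b x y \<oplus> emv_diff b y x)"
    by (rule below_trans[OF below_oplus_emv_diff[OF b _ le(2) _ le(1)] mono(2)]) simp_all
  ultimately show ?R
    using ideal_oplus[OF I mem] by auto
next
  assume ?R
  then obtain i where [simp]: "x \<in> carrier M" "y \<in> carrier M"
    and i: "i \<in> I" "x \<preceq> y \<oplus> i" "y \<preceq> x \<oplus> i" by auto
  have [simp]: "i \<in> carrier M" using ideal_closed[OF I i(1)] .
  obtain b where b: "b \<in> idempotents M" "x \<preceq> b" "y \<preceq> b"
    using idempotent_above2[of x y] by auto
  have mem: "emv_diff b s t \<in> I"
    if [simp]: "s \<in> carrier M" "t \<in> carrier M" and st: "s \<preceq> b" "t \<preceq> b" "s \<preceq> t \<oplus> i" for s t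
  proof -
    have [simp]: "b \<in> carrier M" using idempotentD[OF b(1)] by simp
    have "i \<curlywedge> b \<in> I"
      using ideal_down[OF I wedge_below1 i(1)] by (simp add: wedge_closed)
    moreover have "emv_diff b s t \<preceq> i \<curlywedge> b"
      using below_oplus_wedge[OF st(3,1)] st
      by (intro emv_diff_below[OF b(1)]) (simp_all add: wedge_closed wedge_below2)
    ultimately show ?thesis
      using ideal_down[OF I] emv_diff_closed[OF b(1)] st by auto
  qed
  show ?L
    using b i mem by (auto simp: ideal_congruence_def)
qed

text \<open>The pattern shared by join, meet and +. A one-sided estimate suffices because the
  relation is symmetric, and a common error k suffices because i and j are both below i + j. The
  bound k + k leaves room for +, where the errors of the two arguments add up.\<close>

lemma compatible2_ideal_congruence:
  assumes I: "emv_ideal M I"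
    and cl: "\<And>x y. \<lbrakk>x \<in> carrier M; y \<in> carrier M\<rbrakk> \<Longrightarrow> f x y \<in> carrier M"
    and f: "\<And>x x' y y' k. \<lbrakk>x \<preceq> x' \<oplus> k; y \<preceq> y' \<oplus> k; x \<in> carrier M; x' \<in> carrier M;
      y \<in> carrier M; y' \<in> carrier M; k \<in> carrier M\<rbrakk> \<Longrightarrow> f x y \<preceq> f x' y' \<oplus> (k \<oplus> k)"
  shows "compatible2 (ideal_congruence M I) f"
  unfolding compatible2_def
proof (intro allI impI)
  fix x x' y y'
  assume "(x, x') \<in> ideal_congruence M I" "(y, y') \<in> ideal_congruence M I"
  then obtain i j where [simp]: "x \<in> carrier M" "x' \<in> carrier M" "y \<in> carrier M" "y' \<in> carrier M"
    and ij: "i \<in> I" "j \<in> I"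
    and i: "x \<preceq> x' \<oplus> i" "x' \<preceq> x \<oplus> i" and j: "y \<preceq> y' \<oplus> j" "y' \<preceq> y \<oplus> j"
    unfolding ideal_congruence_iff[OF I] by auto
  have [simp]: "i \<in> carrier M" "j \<in> carrier M" using ideal_closed[OF I] ij by auto
  have up: "s \<preceq> t \<oplus> (i \<oplus> j)" if "s \<preceq> t \<oplus> i \<or> s \<preceq> t \<oplus> j" "s \<in> carrier M" "t \<in> carrier M" for s t
  proof -
    have "t \<oplus> i \<preceq> t \<oplus> (i \<oplus> j)" "t \<oplus> j \<preceq> t \<oplus> (i \<oplus> j)"
      using that by (auto intro!: oplus_mono2 simp: below_oplus1 below_oplus2)
    with that show ?thesis
      using below_trans[of s _ "t \<oplus> (i \<oplus> j)"] by auto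
  qed
  have "(i \<oplus> j) \<oplus> (i \<oplus> j) \<in> I"
    using ij ideal_oplus[OF I] by simp
  moreover have "f x y \<preceq> f x' y' \<oplus> ((i \<oplus> j) \<oplus> (i \<oplus> j))" "f x' y' \<preceq> f x y \<oplus> ((i \<oplus> j) \<oplus> (i \<oplus> j))"
    using i j by (auto intro!: f up)
  ultimately show "(f x y, f x' y') \<in> ideal_congruence M I"
    unfolding ideal_congruence_iff[OF I] using cl by auto
qed

lemma equiv_ideal_congruence:
  assumes I: "emv_ideal M I"
  shows "equiv (carrier M) (ideal_congruence M I)"
proof (rule equivI)
  show "refl_on (carrier M) (ideal_congruence M I)"
    using ideal_zero[OF I]
    by (auto simp: refl_on_def ideal_congruence_iff[OF I] intro!: bexI[of _ \<zero>])
  show "ideal_congruence M I \<subseteq> carrier M \<times> carrier M"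
    by (auto simp: ideal_congruence_def)
  show "sym (ideal_congruence M I)"
    by (auto simp: sym_def ideal_congruence_iff[OF I])
  \<comment> \<open>Chaining two inequalities adds their errors, and I is closed under +.\<close>
  have trans: "x \<preceq> z \<oplus> (i \<oplus> j)"
    if le: "x \<preceq> y \<oplus> i" "y \<preceq> z \<oplus> j" and [simp]: "x \<in> carrier M" "y \<in> carrier M" "z \<in> carrier M"
      "i \<in> carrier M" "j \<in> carrier M" for x y z i j
  proof -
    have "y \<oplus> i \<preceq> (z \<oplus> j) \<oplus> i"
      using le(2) by (intro oplus_mono2) simp_all
    with below_trans[OF le(1) this] show ?thesis by (simp add: oplus_assoc oplus_comm[of j i])
  qed
  show "trans (ideal_congruence M I)"
  proof (rule transI)
    fix x y z
    assume "(x, y) \<in> ideal_congruence M I" "(y, z) \<in> ideal_congruence M I"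
    then obtain i j where [simp]: "x \<in> carrier M" "y \<in> carrier M" "z \<in> carrier M"
      and ij: "i \<in> I" "j \<in> I"
      and i: "x \<preceq> y \<oplus> i" "y \<preceq> x \<oplus> i" and j: "y \<preceq> z \<oplus> j" "z \<preceq> y \<oplus> j"
      unfolding ideal_congruence_iff[OF I] by auto
    have [simp]: "i \<in> carrier M" "j \<in> carrier M" using ideal_closed[OF I] ij by auto
    have "x \<preceq> z \<oplus> (i \<oplus> j)" "z \<preceq> x \<oplus> (i \<oplus> j)"
      using trans[OF i(1) j(1)] trans[OF j(2) i(2)] by (simp_all add: oplus_comm[of j i])
    then show "(x, z) \<in> ideal_congruence M I"
      unfolding ideal_congruence_iff[OF I] using ideal_oplus[OF I ij] by auto
  qed
qed

lemma emv_congruence_ideal_congruence: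
  assumes I: "emv_ideal M I"
  shows "emv_congruence M (ideal_congruence M I)"
  unfolding emv_congruence_def
proof (intro conjI ballI)
  show eq: "equiv (carrier M) (ideal_congruence M I)"
    using I by (rule equiv_ideal_congruence)
  \<comment> \<open>Join and meet cost a single error k; this weakens their estimates to the k + k
    of the common pattern.\<close>
  have dbl: "s \<oplus> k \<preceq> s \<oplus> (k \<oplus> k)" if "s \<in> carrier M" "k \<in> carrier M" for s k
    using that by (intro oplus_mono2) (simp_all add: below_oplus1)
  show "compatible2 (ideal_congruence M I) (vee M)"
  proof (rule compatible2_ideal_congruence[OF I vee_closed], assumption+)
    fix x x' y y' k
    assume le: "x \<preceq> x' \<oplus> k" "y \<preceq> y' \<oplus> k" and [simp]: "x \<in> carrier M" "x' \<in> carrier M"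
      "y \<in> carrier M" "y' \<in> carrier M" "k \<in> carrier M"
    note [simp] = vee_closed
    have "x' \<oplus> k \<preceq> (x' \<curlyvee> y') \<oplus> k" "y' \<oplus> k \<preceq> (x' \<curlyvee> y') \<oplus> k"
      by (auto intro!: oplus_mono2 simp: below_vee1 below_vee2)
    with le have "x \<curlyvee> y \<preceq> (x' \<curlyvee> y') \<oplus> k"
      using below_trans[OF le(1)] below_trans[OF le(2)] by (intro vee_least) simp_all
    then show "x \<curlyvee> y \<preceq> (x' \<curlyvee> y') \<oplus> (k \<oplus> k)"
      by (rule below_trans[OF _ dbl]) simp_all
  qed
  show "compatible2 (ideal_congruence M I) (wedge M)"
  proof (rule compatible2_ideal_congruence[OF I wedge_closed], assumption+)
    fix x x' y y' k
    assume le: "x \<preceq> x' \<oplus> k" "y \<preceq> y' \<oplus> k" and [simp]: "x \<in> carrier M" "x' \<in> carrier M"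
      "y \<in> carrier M" "y' \<in> carrier M" "k \<in> carrier M"
    note [simp] = wedge_closed
    have "x \<curlywedge> y \<preceq> (k \<oplus> x') \<curlywedge> (k \<oplus> y')"
      using below_trans[OF wedge_below1 le(1)] below_trans[OF wedge_below2 le(2)]
      by (intro wedge_greatest) (simp_all add: oplus_comm[of k])
    then have "x \<curlywedge> y \<preceq> k \<oplus> (x' \<curlywedge> y')"
      by (rule below_trans[OF _ wedge_oplus_subdistrib]) simp_all
    then have "x \<curlywedge> y \<preceq> (x' \<curlywedge> y') \<oplus> k" by (simp add: oplus_comm)
    then show "x \<curlywedge> y \<preceq> (x' \<curlywedge> y') \<oplus> (k \<oplus> k)"
      by (rule below_trans[OF _ dbl]) simp_all
  qed
  show plus: "compatible2 (ideal_congruence M I) (oplus M)"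
  proof (rule compatible2_ideal_congruence[OF I oplus_closed], assumption+)
    fix x x' y y' k
    assume le: "x \<preceq> x' \<oplus> k" "y \<preceq> y' \<oplus> k" and [simp]: "x \<in> carrier M" "x' \<in> carrier M"
      "y \<in> carrier M" "y' \<in> carrier M" "k \<in> carrier M"
    have "x \<oplus> y \<preceq> (x' \<oplus> k) \<oplus> (y' \<oplus> k)"
      using le by (intro oplus_mono2) simp_all
    then show "x \<oplus> y \<preceq> (x' \<oplus> y') \<oplus> (k \<oplus> k)"
      by (simp add: oplus_assoc oplus_left_comm[of k y'])
  qed
  fix b
  assume b: "b \<in> idempotents M"
  \<comment> \<open>Negation swaps the two inequalities between x and y, so the same i is a witness
    for the negated pair.\<close>
  have neg: "(emv_lambda M \<zero> b x, emv_lambda M \<zero> b y) \<in> ideal_congruence M I"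
    if "(x, y) \<in> ideal_congruence M I" "x \<preceq> b" "y \<preceq> b" for x y
  proof -
    obtain i where "x \<in> carrier M" "y \<in> carrier M" "i \<in> I" "x \<preceq> y \<oplus> i" "y \<preceq> x \<oplus> i"
      using \<open>(x, y) \<in> ideal_congruence M I\<close> unfolding ideal_congruence_iff[OF I] by auto
    with that show ?thesis
      unfolding ideal_congruence_iff[OF I]
      by (auto simp: emv_lambda_closed[OF b] ideal_closed[OF I]
          intro!: bexI[of _ i] emv_lambda_antimono_mod[OF b])
  qed
  let ?J = "emv_interval M \<zero> b"
  have "equiv ?J (ideal_congruence M I \<inter> ?J \<times> ?J)"
  proof (rule equivI)
    show "refl_on ?J (ideal_congruence M I \<inter> ?J \<times> ?J)"
      using equiv_class_self[OF eq] by (auto simp: refl_on_def interval_iff)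
    show "sym (ideal_congruence M I \<inter> ?J \<times> ?J)"
      using eq by (auto simp: equiv_def sym_def)
    show "trans (ideal_congruence M I \<inter> ?J \<times> ?J)"
      using eq by (auto simp: equiv_def trans_def)
  qed auto
  then show "mv_congruence (interval_mv M \<zero> b) (ideal_congruence M I \<inter> ?J \<times> ?J)"
    using plus unfolding mv_congruence_def interval_mv_def compatible2_def
    by (auto simp: interval_iff neg oplus_below_idempotent[OF b] emv_lambda_closed[OF b]
        emv_lambda_below[OF b])
qed

section \<open>Congruences, the class of zero and the bijection\<close>

lemma emv_congruenceD:
  assumes "emv_congruence M \<theta>"
  shows congruence_equiv: "equiv (carrier M) \<theta>"
    and congruence_wedge: "\<lbrakk>(x, x') \<in> \<theta>; (y, y') \<in> \<theta>\<rbrakk> \<Longrightarrow> (x \<curlywedge> y, x' \<curlywedge> y') \<in> \<theta>"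
    and congruence_oplus: "\<lbrakk>(x, x') \<in> \<theta>; (y, y') \<in> \<theta>\<rbrakk> \<Longrightarrow> (x \<oplus> y, x' \<oplus> y') \<in> \<theta>"
    and congruence_lambda: "\<lbrakk>b \<in> idempotents M; (x, y) \<in> \<theta>; x \<in> carrier M; y \<in> carrier M;
      x \<preceq> b; y \<preceq> b\<rbrakk> \<Longrightarrow> (emv_lambda M \<zero> b x, emv_lambda M \<zero> b y) \<in> \<theta>"
  using assms
  by (auto simp: emv_congruence_def compatible2_def mv_congruence_def interval_mv_def interval_iff)

lemma congruence_closed:
  assumes "emv_congruence M \<theta>" "(x, y) \<in> \<theta>"
  shows "x \<in> carrier M" "y \<in> carrier M"
  using congruence_equiv[OF assms(1)] assms(2) by (auto simp: equiv_def)

lemma congruence_refl: "\<lbrakk>emv_congruence M \<theta>; x \<in> carrier M\<rbrakk> \<Longrightarrow> (x, x) \<in> \<theta>"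
  using congruence_equiv[of \<theta>] by (auto simp: equiv_def refl_on_def)

lemma congruence_sym: "\<lbrakk>emv_congruence M \<theta>; (x, y) \<in> \<theta>\<rbrakk> \<Longrightarrow> (y, x) \<in> \<theta>"
  using congruence_equiv[of \<theta>] by (auto simp: equiv_def sym_def)

lemma congruence_trans: "\<lbrakk>emv_congruence M \<theta>; (x, y) \<in> \<theta>; (y, z) \<in> \<theta>\<rbrakk> \<Longrightarrow> (x, z) \<in> \<theta>"
  using congruence_equiv[of \<theta>] by (auto simp: equiv_def trans_def)

lemma emv_ideal_zero_class:
  assumes c: "emv_congruence M \<theta>"
  shows "emv_ideal M (\<theta> `` {\<zero>})"
  unfolding emv_ideal_def
proof (intro conjI ballI impI)
  show "\<theta> `` {\<zero>} \<subseteq> carrier M" using congruence_closed[OF c] by auto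
  show "\<theta> `` {\<zero>} \<noteq> {}" using congruence_refl[OF c zero_closed] by auto
next
  fix x y assume "x \<in> \<theta> `` {\<zero>}" "y \<in> \<theta> `` {\<zero>}"
  then show "x \<oplus> y \<in> \<theta> `` {\<zero>}"
    using congruence_oplus[OF c, of \<zero> x \<zero> y] by simp
next
  fix x y assume x: "x \<in> carrier M" and y: "y \<in> \<theta> `` {\<zero>}" and le: "x \<preceq> y"
  \<comment> \<open>Meeting the pair (0, y) with x yields (0, x), because x \<le> y.\<close>
  have "(x \<curlywedge> \<zero>, x \<curlywedge> y) \<in> \<theta>"
    using congruence_wedge[OF c congruence_refl[OF c x]] y by auto
  moreover have "x \<curlywedge> \<zero> = \<zero>"
    using zero_below[OF x] wedge_comm[OF x zero_closed] by (simp add: below_iff)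
  ultimately show "x \<in> \<theta> `` {\<zero>}" using le by (simp add: below_iff)
qed

text \<open>For the inclusion of \<theta> in the induced congruence, both differences must be
  related to 0. If s and t are related, then lambda_b s + t is related to lambda_b s + s = b, and
  applying lambda_b relates the difference to lambda_b b = 0.\<close>

lemma ideal_congruence_zero_class:
  assumes c: "emv_congruence M \<theta>"
  shows "ideal_congruence M (\<theta> `` {\<zero>}) = \<theta>"
proof (intro Set.set_eqI iffI; clarify)
  fix x y assume "(x, y) \<in> ideal_congruence M (\<theta> `` {\<zero>})"
  then obtain i where [simp]: "x \<in> carrier M" "y \<in> carrier M" and i: "(\<zero>, i) \<in> \<theta>"
    and le: "x \<preceq> y \<oplus> i" "y \<preceq> x \<oplus> i"
    unfolding ideal_congruence_iff[OF emv_ideal_zero_class[OF c]] by auto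
  \<comment> \<open>Since i is related to 0, t + i is related to t; meeting with s absorbs t + i and
    leaves s on one side.\<close>
  have meet: "(s \<curlywedge> t, s) \<in> \<theta>"
    if s: "s \<in> carrier M" and t: "t \<in> carrier M" and "s \<preceq> t \<oplus> i" for s t
    using congruence_wedge[OF c congruence_refl[OF c s]
        congruence_oplus[OF c congruence_refl[OF c t] i]] that
    by (simp add: below_iff)
  have "(x \<curlywedge> y, x) \<in> \<theta>" "(x \<curlywedge> y, y) \<in> \<theta>"
    using meet[OF _ _ le(1)] meet[OF _ _ le(2)] by (simp_all add: wedge_comm[of y x])
  then show "(x, y) \<in> \<theta>"
    using congruence_sym[OF c] congruence_trans[OF c] by blast
next
  fix x y assume xy: "(x, y) \<in> \<theta>"
  have [simp]: "x \<in> carrier M" "y \<in> carrier M" using congruence_closed[OF c xy] .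
  obtain b where b: "b \<in> idempotents M" "x \<preceq> b" "y \<preceq> b"
    using idempotent_above2[of x y] by auto
  have mem: "(\<zero>, emv_diff b s t) \<in> \<theta>"
    if st: "(s, t) \<in> \<theta>" and [simp]: "s \<preceq> b" "t \<preceq> b" for s t
  proof -
    have [simp]: "s \<in> carrier M" "t \<in> carrier M" using congruence_closed[OF c st] .
    have [simp]: "b \<in> carrier M" using idempotentD[OF b(1)] by simp
    note l = emv_lambda_closed[OF b(1), of s] emv_lambda_below[OF b(1), of s]
    have "(emv_lambda M \<zero> b s \<oplus> t, emv_lambda M \<zero> b s \<oplus> s) \<in> \<theta>"
      using congruence_oplus[OF c congruence_refl[OF c] congruence_sym[OF c st]] l by simp
    from congruence_sym[OF c this] have "(b, emv_lambda M \<zero> b s \<oplus> t) \<in> \<theta>"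
      using oplus_emv_lambda[OF b(1), of s] l by (simp add: oplus_comm[of _ s])
    from congruence_lambda[OF c b(1) this] show ?thesis
      using l oplus_below_idempotent[OF b(1)] by (simp add: emv_lambda_top[OF b(1)])
  qed
  show "(x, y) \<in> ideal_congruence M (\<theta> `` {\<zero>})"
    using b mem[OF xy b(2,3)] mem[OF congruence_sym[OF c xy] b(3,2)]
    by (auto simp: ideal_congruence_def)
qed

text \<open>Being related to 0 with error i means x \<le> i, so x is in I by downward closure.
  Conversely, a member x of I is its own error term.\<close>

lemma zero_class_ideal_congruence:
  assumes I: "emv_ideal M I"
  shows "ideal_congruence M I `` {\<zero>} = I"
proof (intro Set.set_eqI iffI)
  fix x assume "x \<in> ideal_congruence M I `` {\<zero>}"
  then show "x \<in> I"
    using ideal_down[OF I, of x] by (auto simp: ideal_congruence_iff[OF I] ideal_closed[OF I])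
next
  fix x assume x: "x \<in> I"
  then show "x \<in> ideal_congruence M I `` {\<zero>}"
    using ideal_closed[OF I x] by (auto simp: ideal_congruence_iff[OF I] intro!: bexI[of _ x])
qed

text \<open>The inverse sends a congruence to its class of 0; both compositions were shown to be
  identities above.\<close>

lemma bij_betw_ideal_congruence:
  "bij_betw (ideal_congruence M) {I. emv_ideal M I} {\<theta>. emv_congruence M \<theta>}"
  by (rule bij_betw_byWitness[where f' = "\<lambda>\<theta>. \<theta> `` {\<zero>}"])
    (auto simp: zero_class_ideal_congruence ideal_congruence_zero_class
      emv_congruence_ideal_congruence emv_ideal_zero_class simp del: Image_singleton_iff)

end

theorem theorem3p16:
  fixes M :: "('a, 'b) emv_struct_scheme"
  assumes "emv_algebra M"
  shows "(\<forall>\<theta>. emv_congruence M \<theta> \<longrightarrow> emv_ideal M (\<theta> `` {zero M})) \<and>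
         (\<forall>I. emv_ideal M I \<longrightarrow> emv_congruence M (ideal_congruence M I)) \<and>
         bij_betw (ideal_congruence M) {I. emv_ideal M I} {\<theta>. emv_congruence M \<theta>}"
  using emv_algebra.emv_ideal_zero_class[OF assms]
    emv_algebra.emv_congruence_ideal_congruence[OF assms]
    emv_algebra.bij_betw_ideal_congruence[OF assms]
  by blast

end
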